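(* Let $X$ be an infinite Hausdorff space which is totally disconnected and first countable. Then $\mathcal{O}_{cs}(X)$ is a closed subset of $X$.
   Context: For a Hausdorff space $X$, $\mathcal{F}(X)$ denotes the set of all nonempty closed subsets of $X$, endowed with the Vietoris topology, which is generated by all sets of the form $\langle\mathcal{V}\rangle=\{S\in\mathcal{F}(X): S\subseteq\bigcup\mathcal{V}\text{ and } S\cap V\neq\emptyset\text{ for all }V\in\mathcal{V}\}$, where $\mathcal{V}$ runs over the finite families of open subsets of $X$. A selection for $\mathcal{F}(X)$ is a map $f:\mathcal{F}(X)\to X$ with $f(S)\in S$ for every $S\in\mathcal{F}(X)$; it is continuous if it is continuous with respect to the Vietoris topology. Set $\mathcal{O}_{cs}(X)=\{f(X): f \text{ is a continuous selection for } \mathcal{F}(X)\}\subseteq X$ (this is empty if there are no continuous selections). A space $Y$ is totally disconnected if each singleton of $Y$ is an intersection of clopen subsets of $Y$ (equivalently, all quasi-components of $Y$ are singletons). *)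

theory Defs
  imports "HOL-Analysis.Analysis"
begin

definition closed_hyperspace :: "'a topology \<Rightarrow> 'a set set"
  where "closed_hyperspace X = {S. closedin X S \<and> S \<noteq> {}}"

definition vietoris_basic :: "'a topology \<Rightarrow> 'a set set \<Rightarrow> 'a set set"
  where "vietoris_basic X \<V> =
    {S \<in> closed_hyperspace X. S \<subseteq> \<Union>\<V> \<and> (\<forall>V\<in>\<V>. S \<inter> V \<noteq> {})}"

definition vietoris_topology :: "'a topology \<Rightarrow> 'a set topology"
  where "vietoris_topology X =
    topology_generated_by {vietoris_basic X \<V> |\<V>. finite \<V> \<and> (\<forall>V\<in>\<V>. openin X V)}"

lemma topspace_vietoris_topology [simp]:
  "topspace (vietoris_topology X) = closed_hyperspace X"
proof -
  have eq: "vietoris_basic X {topspace X} = closed_hyperspace X"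
    by (auto simp: vietoris_basic_def closed_hyperspace_def closedin_def)
  let ?B = "{vietoris_basic X \<V> |\<V>. finite \<V> \<and> (\<forall>V\<in>\<V>. openin X V)}"
  have "closed_hyperspace X \<in> ?B"
    unfolding mem_Collect_eq by (intro exI[of _ "{topspace X}"]) (simp add: eq)
  moreover have "A \<subseteq> closed_hyperspace X" if "A \<in> ?B" for A
    using that unfolding vietoris_basic_def by blast
  ultimately have "\<Union>?B = closed_hyperspace X"
    by (intro equalityI Union_least Union_upper)
  then show ?thesis
    unfolding vietoris_topology_def topology_generated_by_topspace .
qed

text \<open>A selection is a total HOL function; only its values on \<^term>\<open>closed_hyperspace X\<close> matter.\<close>

definition selection :: "'a topology \<Rightarrow> ('a set \<Rightarrow> 'a) \<Rightarrow> bool"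
  where "selection X f \<longleftrightarrow> (\<forall>S\<in>closed_hyperspace X. f S \<in> S)"

definition continuous_selection :: "'a topology \<Rightarrow> ('a set \<Rightarrow> 'a) \<Rightarrow> bool"
  where "continuous_selection X f \<longleftrightarrow>
    selection X f \<and> continuous_map (vietoris_topology X) X f"

text \<open>Meaningful for nonempty \<open>X\<close> only: otherwise \<^term>\<open>topspace X\<close> is not a member of
  \<^term>\<open>closed_hyperspace X\<close> and \<open>f (topspace X)\<close> is an arbitrary value.\<close>

definition O_cs :: "'a topology \<Rightarrow> 'a set"
  where "O_cs X = {f (topspace X) |f. continuous_selection X f}"

text \<open>This is the strong sense of total disconnectedness: the quasi-components, not merely the
  connected components, are singletons.  Requiring \<open>\<C>\<close> to be nonempty would make no difference,
  since \<^term>\<open>topspace X\<close> may always be added to it.\<close>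

definition totally_disconnected_space :: "'a topology \<Rightarrow> bool"
  where "totally_disconnected_space X \<longleftrightarrow>
    (\<forall>x\<in>topspace X. \<exists>\<C>. (\<forall>C\<in>\<C>. openin X C \<and> closedin X C) \<and> {x} = \<Inter>\<C>)"

end

theory Submission
  imports Defs
begin

text \<open>If \<open>f\<close> is a continuous selection and \<open>U\<close> is a neighbourhood of \<open>f(X)\<close>, then some finite
  \<open>F\<close> satisfies \<open>f(S) \<in> U\<close> for all closed \<open>S \<supseteq> F\<close>; taking \<open>S = (X - U) \<union> F\<close> yields a closed set
  \<open>T \<supseteq> X - U\<close> and a point \<open>q \<notin> T\<close> with \<open>f(T \<union> {q}) = q\<close>. If \<open>C\<close> is a clopen set containing \<open>q\<close>
  but not \<open>f(T)\<close>, then \<open>{x \<in> C. f(T \<union> {x}) = x}\<close> is clopen, contains \<open>q\<close> and is contained in \<open>U\<close>.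

  Hence every neighbourhood of a point \<open>p\<close> in the closure of \<open>O\<^sub>c\<^sub>s(X)\<close> contains a nonempty clopen
  set, and by first countability there are nonempty clopen sets \<open>C\<^sub>0, C\<^sub>1, \<dots>\<close> converging to \<open>p\<close>.
  Let \<open>g(S) = p\<close> if \<open>S\<close> meets every \<open>C\<^sub>n\<close>; otherwise let \<open>n\<close> be the least index with
  \<open>S \<inter> C\<^sub>n = \<emptyset>\<close>, and set \<open>g(S) = f(S \<inter> C\<^bsub>n-1\<^esub>)\<close>, or \<open>g(S) = f(S)\<close> if \<open>n = 0\<close>. This is a
  continuous selection with \<open>g(X) = p\<close>.\<close>

section \<open>Open sets of the Vietoris topology and continuous maps into it\<close>

lemma openin_vietoris_basic:
  assumes "finite \<V>" "\<And>V. V \<in> \<V> \<Longrightarrow> openin X V"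
  shows "openin (vietoris_topology X) (vietoris_basic X \<V>)"
  unfolding vietoris_topology_def
  by (rule topology_generated_by_Basis) (use assms in blast)

lemma openin_vietoris_subset:
  assumes "openin X U"
  shows "openin (vietoris_topology X) {S \<in> closed_hyperspace X. S \<subseteq> U}"
proof -
  have "{S \<in> closed_hyperspace X. S \<subseteq> U} = vietoris_basic X {U}"
    by (auto simp: vietoris_basic_def closed_hyperspace_def)
  then show ?thesis
    using openin_vietoris_basic[of "{U}" X] assms by simp
qed

lemma openin_vietoris_meets:
  assumes "openin X U"
  shows "openin (vietoris_topology X) {S \<in> closed_hyperspace X. S \<inter> U \<noteq> {}}"
proof -
  have "{S \<in> closed_hyperspace X. S \<inter> U \<noteq> {}} = vietoris_basic X {topspace X, U}"
    by (auto simp: vietoris_basic_def closed_hyperspace_def dest: closedin_subset)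
  then show ?thesis
    using openin_vietoris_basic[of "{topspace X, U}" X] assms by fastforce
qed

text \<open>Each \<open>vietoris_basic X \<V>\<close> is the finite intersection of the condition of
  lying in \<open>\<Union>\<V>\<close> with the conditions of meeting each \<open>V\<close>, so
  preimages of these two kinds suffice.\<close>

lemma continuous_map_into_vietoris:
  assumes "\<And>y. y \<in> topspace Y \<Longrightarrow> g y \<in> closed_hyperspace X"
    and "\<And>U. openin X U \<Longrightarrow> openin Y {y \<in> topspace Y. g y \<subseteq> U}"
    and "\<And>U. openin X U \<Longrightarrow> openin Y {y \<in> topspace Y. g y \<inter> U \<noteq> {}}"
  shows "continuous_map Y (vietoris_topology X) g"
  unfolding vietoris_topology_def
proof (rule continuous_on_generated_topo)
  fix W assume "W \<in> {vietoris_basic X \<V> |\<V>. finite \<V> \<and> (\<forall>V\<in>\<V>. openin X V)}"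
  then obtain \<V> where W: "W = vietoris_basic X \<V>" and \<V>: "finite \<V>" "\<forall>V\<in>\<V>. openin X V"
    by blast
  have "g -` W \<inter> topspace Y =
      {y \<in> topspace Y. g y \<subseteq> \<Union>\<V>} \<inter> \<Inter>((\<lambda>V. {y \<in> topspace Y. g y \<inter> V \<noteq> {}}) ` \<V>)"
    using assms(1) by (auto simp: W vietoris_basic_def)
  also have "openin Y \<dots>"
    by (rule openin_Int_Inter) (use \<V> assms(2)[of "\<Union>\<V>"] assms(3) in auto)
  finally show "openin Y (g -` W \<inter> topspace Y)" .
next
  have "\<Union> {vietoris_basic X \<V> |\<V>. finite \<V> \<and> (\<forall>V\<in>\<V>. openin X V)} = closed_hyperspace X"
    using topspace_vietoris_topology[of X]
    unfolding vietoris_topology_def topology_generated_by_topspace .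
  then show "g ` topspace Y \<subseteq> \<Union> {vietoris_basic X \<V> |\<V>. finite \<V> \<and> (\<forall>V\<in>\<V>. openin X V)}"
    using assms(1) by auto
qed

lemma continuous_map_insert_vietoris:
  assumes "t1_space X" "closedin X T"
  shows "continuous_map X (vietoris_topology X) (\<lambda>x. insert x T)"
proof (rule continuous_map_into_vietoris)
  fix x assume "x \<in> topspace X"
  then have "closedin X {x}"
    using assms(1) by (simp add: t1_space_closedin_singleton)
  then show "insert x T \<in> closed_hyperspace X"
    using closedin_Un[OF _ assms(2)] by (fastforce simp: closed_hyperspace_def)
next
  fix U assume U: "openin X U"
  have "{x \<in> topspace X. insert x T \<subseteq> U} = (if T \<subseteq> U then U else {})"
    using openin_subset[OF U] by auto
  then show "openin X {x \<in> topspace X. insert x T \<subseteq> U}"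
    using U by simp
  have "{x \<in> topspace X. insert x T \<inter> U \<noteq> {}} = (if T \<inter> U = {} then U else topspace X)"
    using openin_subset[OF U] by auto
  then show "openin X {x \<in> topspace X. insert x T \<inter> U \<noteq> {}}"
    using U by simp
qed

text \<open>Closedness of \<open>C\<close> makes \<open>U \<union> (topspace X - C)\<close> open,
  which handles containment of \<open>S \<inter> C\<close> in \<open>U\<close>; openness of
  \<open>C\<close> makes \<open>C \<inter> U\<close> open, which handles meeting \<open>U\<close>.
  The subtopology keeps the values nonempty.\<close>

lemma continuous_map_Int_clopen_vietoris:
  assumes "openin X C" "closedin X C"
  shows "continuous_map
    (subtopology (vietoris_topology X) {S \<in> closed_hyperspace X. S \<inter> C \<noteq> {}})
    (vietoris_topology X) (\<lambda>S. S \<inter> C)"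
proof (rule continuous_map_into_vietoris)
  let ?H = "{S \<in> closed_hyperspace X. S \<inter> C \<noteq> {}}"
  have top: "topspace (subtopology (vietoris_topology X) ?H) = ?H"
    by auto
  show "S \<inter> C \<in> closed_hyperspace X"
    if "S \<in> topspace (subtopology (vietoris_topology X) ?H)" for S
    using that assms(2) by (auto simp: closed_hyperspace_def)
  fix U assume U: "openin X U"
  have "openin X (U \<union> (topspace X - C))" "openin X (C \<inter> U)"
    using U assms by auto
  note opens = openin_vietoris_subset[OF this(1)] openin_vietoris_meets[OF this(2)]
  have "{S \<in> ?H. S \<inter> C \<subseteq> U} = {S \<in> closed_hyperspace X. S \<subseteq> U \<union> (topspace X - C)} \<inter> ?H"
    by (auto simp: closed_hyperspace_def dest: closedin_subset)
  then show "openin (subtopology (vietoris_topology X) ?H)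
      {S \<in> topspace (subtopology (vietoris_topology X) ?H). S \<inter> C \<subseteq> U}"
    unfolding top using openin_subtopology_Int[OF opens(1)] by simp
  have "{S \<in> ?H. S \<inter> C \<inter> U \<noteq> {}} = {S \<in> closed_hyperspace X. S \<inter> (C \<inter> U) \<noteq> {}} \<inter> ?H"
    by auto
  then show "openin (subtopology (vietoris_topology X) ?H)
      {S \<in> topspace (subtopology (vietoris_topology X) ?H). S \<inter> C \<inter> U \<noteq> {}}"
    unfolding top using openin_subtopology_Int[OF opens(2)] by simp
qed

section \<open>Clopen sets near the value of a selection at the whole space\<close>

text \<open>If a basic set contains the whole space, its family covers \<open>X\<close>, so only the
  meeting conditions remain; one point from each member enforces them. Such finite sets survive
  finite intersections and unions.\<close>

lemma openin_vietoris_finite_witness: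
  assumes "openin (vietoris_topology X) W" "topspace X \<in> W"
  obtains F where "finite F" "F \<subseteq> topspace X"
    "\<And>S. S \<in> closed_hyperspace X \<Longrightarrow> F \<subseteq> S \<Longrightarrow> S \<in> W"
proof -
  have "generate_topology_on
      {vietoris_basic X \<V> |\<V>. finite \<V> \<and> (\<forall>V\<in>\<V>. openin X V)} W"
    using assms(1) unfolding vietoris_topology_def by (rule openin_topology_generated_by)
  then have "topspace X \<in> W \<Longrightarrow> \<exists>F. finite F \<and> F \<subseteq> topspace X \<and>
      (\<forall>S\<in>closed_hyperspace X. F \<subseteq> S \<longrightarrow> S \<in> W)"
  proof (induction rule: generate_topology_on.induct)
    case Empty
    then show ?case by simp
  next
    case (Int A B)
    then have "topspace X \<in> A" "topspace X \<in> B"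
      by auto
    with Int.IH obtain F G where "finite F" "F \<subseteq> topspace X" "\<forall>S\<in>closed_hyperspace X. F \<subseteq> S \<longrightarrow> S \<in> A"
      and "finite G" "G \<subseteq> topspace X" "\<forall>S\<in>closed_hyperspace X. G \<subseteq> S \<longrightarrow> S \<in> B"
      by blast
    then show ?case
      by (intro exI[of _ "F \<union> G"]) auto
  next
    case (UN \<K>)
    then obtain K where "K \<in> \<K>" "topspace X \<in> K"
      by blast
    with UN.IH[of K] obtain F where "finite F" "F \<subseteq> topspace X"
      "\<forall>S\<in>closed_hyperspace X. F \<subseteq> S \<longrightarrow> S \<in> K"
      by blast
    with \<open>K \<in> \<K>\<close> show ?case
      by (intro exI[of _ F]) auto
  next
    case (Basis W)
    then obtain \<V> where W: "W = vietoris_basic X \<V>" and "finite \<V>"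
      by blast
    have meet: "\<forall>V\<in>\<V>. \<exists>x. x \<in> topspace X \<inter> V" and cover: "topspace X \<subseteq> \<Union>\<V>"
      using Basis.prems by (auto simp: W vietoris_basic_def)
    obtain c where c: "\<forall>V\<in>\<V>. c V \<in> topspace X \<inter> V"
      using bchoice[OF meet] by blast
    have "S \<in> W" if "S \<in> closed_hyperspace X" "c ` \<V> \<subseteq> S" for S
    proof -
      have "S \<subseteq> topspace X"
        using that(1) by (auto simp: closed_hyperspace_def dest: closedin_subset)
      then have "S \<subseteq> \<Union>\<V>"
        using cover by (rule subset_trans)
      moreover have "\<forall>V\<in>\<V>. S \<inter> V \<noteq> {}"
        using that(2) c by auto
      ultimately show ?thesis
        using that(1) by (simp add: W vietoris_basic_def)
    qed
    then show ?case
      using \<open>finite \<V>\<close> c by (intro exI[of _ "c ` \<V>"]) auto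
  qed
  with assms(2) that show thesis by blast
qed

lemma totally_disconnected_space_clopen_separation:
  assumes "totally_disconnected_space X" "x \<in> topspace X" "y \<noteq> x"
  obtains C where "openin X C" "closedin X C" "x \<in> C" "y \<notin> C"
proof -
  obtain \<C> where \<C>: "\<And>C. C \<in> \<C> \<Longrightarrow> openin X C \<and> closedin X C" "{x} = \<Inter>\<C>"
    using assms(1,2) unfolding totally_disconnected_space_def by meson
  have "y \<notin> \<Inter>\<C>"
    using assms(3) by (simp flip: \<C>(2))
  then obtain C where C: "C \<in> \<C>" "y \<notin> C"
    by auto
  have "x \<in> \<Inter>\<C>"
    by (simp flip: \<C>(2))
  with C \<C>(1)[OF C(1)] show thesis
    by (intro that[of C]) auto
qed

text \<open>The clopen set consists of the points of \<open>C\<close> fixed by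
  \<open>x \<mapsto> f (insert x T)\<close>. It is closed as an equalizer in a Hausdorff space, and
  open because a point of \<open>C\<close> that is not fixed is sent into the closed set
  \<open>T\<close>.\<close>

lemma nonempty_clopen_subset_of_selection_nhd:
  assumes "Hausdorff_space X" "totally_disconnected_space X"
    and f: "continuous_selection X f"
    and nonempty: "topspace X \<noteq> {}" and U: "openin X U" "f (topspace X) \<in> U"
  obtains C where "openin X C" "closedin X C" "C \<noteq> {}" "C \<subseteq> U"
proof -
  have sel: "f S \<in> S" if "S \<in> closed_hyperspace X" for S
    using f that by (auto simp: continuous_selection_def selection_def)
  have cont: "continuous_map (vietoris_topology X) X f"
    using f by (simp add: continuous_selection_def)
  have "topspace X \<in> closed_hyperspace X"
    using nonempty by (simp add: closed_hyperspace_def)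
  then obtain F where F: "finite F" "F \<subseteq> topspace X"
    and fU: "\<And>S. S \<in> closed_hyperspace X \<Longrightarrow> F \<subseteq> S \<Longrightarrow> f S \<in> U"
    using openin_vietoris_finite_witness[OF openin_continuous_map_preimage[OF cont U(1)]] U(2)
    by (smt (verit) mem_Collect_eq topspace_vietoris_topology)
  show thesis
  \<comment> \<open>A selection is constrained only on nonempty sets. In the degenerate case
    \<open>U\<close> is the whole space, hence itself clopen.\<close>
  proof (cases "(topspace X - U) \<union> F = {}")
    case True
    then have "U = topspace X"
      using openin_subset[OF U(1)] by blast
    then show thesis
      using that[of U] U nonempty by auto
  next
    case False
    have closed: "closedin X ((topspace X - U) \<union> G)" if "G \<subseteq> F" for G
    proof (rule closedin_Un)
      show "closedin X (topspace X - U)"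
        using U(1) by blast
      show "closedin X G"
        using that F finite_subset by (intro closedin_Hausdorff_finite assms(1)) blast+
    qed
    define q where "q = f ((topspace X - U) \<union> F)"
    have hyp: "(topspace X - U) \<union> F \<in> closed_hyperspace X"
      using False closed[of F] by (simp add: closed_hyperspace_def)
    have q: "q \<in> U" "q \<in> F"
      using fU[OF hyp] sel[OF hyp] by (auto simp: q_def)
    \<comment> \<open>Since \<open>q\<close> lies in both \<open>U\<close> and \<open>F\<close>,
      removing it from \<open>F\<close> really removes it from the set, and inserting it again
      restores the set at which \<open>f\<close> takes the value \<open>q\<close>.\<close>
    define T where "T = (topspace X - U) \<union> (F - {q})"
    have T: "closedin X T" "q \<notin> T" "topspace X - U \<subseteq> T"
      using closed[of "F - {q}"] q by (auto simp: T_def)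
    have "insert q T = (topspace X - U) \<union> F"
      using q by (auto simp: T_def)
    then have fq: "f (insert q T) = q"
      by (simp add: q_def)
    show thesis
    proof (cases "T = {}")
      case True
      then have "U = topspace X"
        using T(3) openin_subset[OF U(1)] by blast
      then show thesis
        using that[of U] U nonempty by auto
    next
      case False
      then have fT: "f T \<in> T"
        using sel T(1) by (simp add: closed_hyperspace_def)
      \<comment> \<open>Excluding \<open>f T\<close> keeps fixed points in \<open>C\<close> out of
        \<open>T\<close>: for \<open>x\<close> in \<open>T\<close>, \<open>insert x T = T\<close>,
        so a fixed point would equal \<open>f T\<close>.\<close>
      obtain C where C: "openin X C" "closedin X C" "q \<in> C" "f T \<notin> C"
        using totally_disconnected_space_clopen_separation[OF assms(2), of q "f T"] q F T(2) fT
        by blast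
      let ?h = "\<lambda>x. f (insert x T)"
      have insert_cont: "continuous_map X (vietoris_topology X) (\<lambda>x. insert x T)"
        by (rule continuous_map_insert_vietoris) (simp_all add: assms(1) Hausdorff_imp_t1_space T(1))
      have h: "continuous_map X X ?h"
        using continuous_map_compose[OF insert_cont cont] by (simp add: o_def)
      have h_cases: "?h x = x \<or> ?h x \<in> T" if "x \<in> topspace X" for x
        using continuous_map_image_subset_topspace[OF insert_cont] sel[of "insert x T"] that by auto
      let ?A = "{x \<in> topspace X. ?h x = x} \<inter> C"
      have "closedin X ?A"
        using closedin_continuous_maps_eq[OF assms(1) h continuous_map_id] C(2) by auto
      moreover have "openin X ?A"
      proof -
        have "?A = C - {x \<in> topspace X. ?h x \<in> T}"
        proof (intro equalityI subsetI)
          fix x assume x: "x \<in> ?A"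
          have "?h x \<notin> T"
          proof
            assume "?h x \<in> T"
            with x have "insert x T = T" by auto
            with x C(4) show False by auto
          qed
          then show "x \<in> C - {x \<in> topspace X. ?h x \<in> T}"
            using x by blast
        next
          fix x assume "x \<in> C - {x \<in> topspace X. ?h x \<in> T}"
          then show "x \<in> ?A"
            using h_cases openin_subset[OF C(1)] by blast
        qed
        then show ?thesis
          using C(1) closedin_continuous_map_preimage[OF h T(1)] by (simp add: openin_diff)
      qed
      moreover have "q \<in> ?A"
        using fq q F(2) C(3) by auto
      moreover have "?A \<subseteq> U"
      proof
        fix x assume x: "x \<in> ?A"
        show "x \<in> U"
        proof (rule ccontr)
          assume "x \<notin> U"
          with x T(3) have "insert x T = T" by auto
          with x C(4) show False by auto
        qed
      qed
      ultimately show thesis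
        using that by blast
    qed
  qed
qed

section \<open>Decreasing countable neighbourhood bases\<close>

lemma first_countable_decreasing_base:
  assumes "first_countable X" "p \<in> topspace X"
  obtains W :: "nat \<Rightarrow> 'a set" where "\<And>n. openin X (W n)" "\<And>n. p \<in> W n" "decseq W"
    "\<And>U. openin X U \<Longrightarrow> p \<in> U \<Longrightarrow> \<exists>n. W n \<subseteq> U"
proof -
  obtain \<B> where \<B>: "countable \<B>" "\<forall>V\<in>\<B>. openin X V"
    "\<And>U. openin X U \<Longrightarrow> p \<in> U \<Longrightarrow> \<exists>V\<in>\<B>. p \<in> V \<and> V \<subseteq> U"
    using assms unfolding first_countable_def by meson
  define \<N> where "\<N> = {V \<in> \<B>. p \<in> V}"
  have "countable \<N>" "\<N> \<noteq> {}"
    using \<B>(1) \<B>(3)[OF openin_topspace assms(2)] by (auto simp: \<N>_def)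
  then obtain V :: "nat \<Rightarrow> 'a set" where V: "range V = \<N>"
    using range_from_nat_into[of \<N>] by metis
  define W where "W n = (\<Inter>i\<le>n. V i)" for n
  have "V i \<in> \<N>" for i
    using V by blast
  then have V_nhd: "openin X (V i)" "p \<in> V i" for i
    using \<B>(2) unfolding \<N>_def by blast+
  show thesis
  proof (rule that[of W])
    show "openin X (W n)" for n
      unfolding W_def by (rule openin_Inter) (auto simp: V_nhd)
    show "p \<in> W n" for n
      by (auto simp: W_def V_nhd)
    show "decseq W"
      by (rule decseq_SucI) (auto simp: W_def)
    fix U assume "openin X U" "p \<in> U"
    then obtain B where "B \<in> \<N>" "B \<subseteq> U"
      using \<B>(3) unfolding \<N>_def by blast
    then obtain n where "V n \<subseteq> U"
      using V by blast
    then show "\<exists>n. W n \<subseteq> U"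
      by (intro exI[of _ n]) (auto simp: W_def)
  qed
qed

section \<open>The selection governed by the first missed clopen set\<close>

text \<open>In the \<open>Suc n\<close> branch the first missed set is \<open>C (Suc n)\<close>, so
  \<open>C n\<close> is the last set met before it and \<open>S \<inter> C n\<close> is
  nonempty.\<close>

definition first_miss_selection ::
    "('a set \<Rightarrow> 'a) \<Rightarrow> (nat \<Rightarrow> 'a set) \<Rightarrow> 'a \<Rightarrow> 'a set \<Rightarrow> 'a"
  where "first_miss_selection f C p S =
    (if \<forall>n. S \<inter> C n \<noteq> {} then p
     else case LEAST n. S \<inter> C n = {} of 0 \<Rightarrow> f S | Suc n \<Rightarrow> f (S \<inter> C n))"

lemma first_miss_selection_meets_all:
  "(\<And>n. S \<inter> C n \<noteq> {}) \<Longrightarrow> first_miss_selection f C p S = p"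
  by (simp add: first_miss_selection_def)

lemma first_miss_selection_first_miss:
  assumes "S \<inter> C n = {}" "\<And>i. i < n \<Longrightarrow> S \<inter> C i \<noteq> {}"
  shows "first_miss_selection f C p S = (case n of 0 \<Rightarrow> f S | Suc m \<Rightarrow> f (S \<inter> C m))"
proof -
  have "(LEAST n. S \<inter> C n = {}) = n"
    using assms by (intro Least_equality) (auto simp: not_less[symmetric])
  then show ?thesis
    using assms(1) by (auto simp: first_miss_selection_def)
qed

lemma first_miss_cases:
  obtains "\<And>n. S \<inter> C n \<noteq> {}"
  | n :: nat where "S \<inter> C n = {}" "\<And>i. i < n \<Longrightarrow> S \<inter> C i \<noteq> {}"
proof (cases "\<exists>n. S \<inter> C n = {}")
  case True
  then obtain n where "S \<inter> C n = {}" "\<forall>i<n. S \<inter> C i \<noteq> {}"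
    using exists_least_iff[of "\<lambda>n. S \<inter> C n = {}"] by auto
  then show thesis
    using that(2)[of n] by simp
qed (use that(1) in simp)

text \<open>Near a set with a first miss, the index of that miss is locally constant because the
  \<open>C n\<close> are clopen, and continuity comes from \<open>f\<close>. Near a set meeting
  every \<open>C n\<close>, a late first miss forces the value close to \<open>p\<close>.\<close>

lemma continuous_selection_first_miss:
  assumes f: "continuous_selection X f" and p: "p \<in> topspace X"
    and C: "\<And>n. openin X (C n)" "\<And>n. closedin X (C n)"
    and conv: "\<And>U. openin X U \<Longrightarrow> p \<in> U \<Longrightarrow> \<exists>n. \<forall>m\<ge>n. C m \<subseteq> U"
  shows "continuous_selection X (first_miss_selection f C p)"
proof -
  let ?g = "first_miss_selection f C p"
  let ?V = "vietoris_topology X"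
  have sel: "f S \<in> S" if "S \<in> closed_hyperspace X" for S
    using f that by (auto simp: continuous_selection_def selection_def)
  have cont: "continuous_map ?V X f"
    using f by (simp add: continuous_selection_def)
  have fC: "f (S \<inter> C n) \<in> S \<inter> C n" if "S \<in> closed_hyperspace X" "S \<inter> C n \<noteq> {}" for S n
    using sel[of "S \<inter> C n"] that C(2) by (auto simp: closed_hyperspace_def)
  have g_sel: "?g S \<in> S" if S: "S \<in> closed_hyperspace X" for S
  proof (cases rule: first_miss_cases[of S C])
    case 1
    \<comment> \<open>Otherwise the complement of the closed set \<open>S\<close> is a neighbourhood
      of \<open>p\<close> and contains some \<open>C n\<close>, which \<open>S\<close> would then
      miss.\<close>
    have "p \<in> S"
    proof (rule ccontr)
      assume "p \<notin> S"
      moreover have "openin X (topspace X - S)"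
        using S by (auto simp: closed_hyperspace_def)
      ultimately obtain n where "C n \<subseteq> topspace X - S"
        using conv[of "topspace X - S"] p by blast
      with 1[of n] show False by blast
    qed
    with 1 show ?thesis by (simp add: first_miss_selection_meets_all)
  next
    case (2 n)
    have "?g S = (case n of 0 \<Rightarrow> f S | Suc m \<Rightarrow> f (S \<inter> C m))"
      using 2 by (rule first_miss_selection_first_miss)
    then show ?thesis
      using sel[OF S] fC[OF S 2(2)] by (cases n) auto
  qed
  \<comment> \<open>Inserting \<open>closed_hyperspace X\<close> makes \<open>P 0\<close> the whole
    hyperspace instead of the intersection of an empty family.\<close>
  define P where
    "P n = \<Inter>(insert (closed_hyperspace X) ((\<lambda>i. {S \<in> closed_hyperspace X. S \<inter> C i \<noteq> {}}) ` {..<n}))"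
    for n
  have P_iff: "S \<in> P n \<longleftrightarrow> S \<in> closed_hyperspace X \<and> (\<forall>i<n. S \<inter> C i \<noteq> {})" for S n
    by (auto simp: P_def)
  have P_open: "openin ?V (P n)" for n
    unfolding P_def
    using openin_vietoris_meets[OF C(1)] openin_topspace[of ?V]
    by (intro openin_Inter) auto
  have "openin ?V {S \<in> topspace ?V. ?g S \<in> U}" if U: "openin X U" for U
  proof (subst openin_subopen, intro ballI)
    fix S assume "S \<in> {S \<in> topspace ?V. ?g S \<in> U}"
    then have S: "S \<in> closed_hyperspace X" "?g S \<in> U" by auto
    show "\<exists>T. openin ?V T \<and> S \<in> T \<and> T \<subseteq> {S \<in> topspace ?V. ?g S \<in> U}"
    proof (cases rule: first_miss_cases[of S C])
      case 1
      then have "p \<in> U"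
        using S(2) by (simp add: first_miss_selection_meets_all)
      then obtain n where n: "\<And>m. m \<ge> n \<Longrightarrow> C m \<subseteq> U"
        using conv[OF U] by blast
      \<comment> \<open>Meeting \<open>C 0\<close> to \<open>C n\<close> puts any first miss at some
        \<open>k \<ge> n + 1\<close>, so the value lies in \<open>C (k - 1)\<close> with
        \<open>k - 1 \<ge> n\<close>, hence in \<open>U\<close>.\<close>
      have "?g T \<in> U" if T: "T \<in> P (Suc n)" for T
      proof (cases rule: first_miss_cases[of T C])
        case 1
        then show ?thesis
          using \<open>p \<in> U\<close> by (simp add: first_miss_selection_meets_all)
      next
        case (2 k)
        have "k \<ge> Suc n"
          using T 2(1) by (metis P_iff not_less)
        then obtain m where m: "k = Suc m" "m \<ge> n"
          by (cases k) auto
        have "?g T = (case k of 0 \<Rightarrow> f T | Suc m \<Rightarrow> f (T \<inter> C m))"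
          using 2 by (rule first_miss_selection_first_miss)
        then have "?g T = f (T \<inter> C m)"
          using m(1) by simp
        moreover have "f (T \<inter> C m) \<in> C m"
          using fC T 2(2)[of m] m(1) by (auto simp: P_iff)
        ultimately show ?thesis
          using n[OF m(2)] by auto
      qed
      moreover have "S \<in> P (Suc n)"
        using S(1) 1 by (simp add: P_iff)
      ultimately show ?thesis
        using P_open[of "Suc n"] by (intro exI[of _ "P (Suc n)"]) (auto simp: P_iff)
    next
      case (2 n)
      \<comment> \<open>On \<open>?Q\<close> the first miss is exactly \<open>n\<close>; missing
        \<open>C n\<close> is an open condition because \<open>C n\<close> is closed.\<close>
      let ?Q = "P n \<inter> {S \<in> closed_hyperspace X. S \<subseteq> topspace X - C n}"
      have Q_open: "openin ?V ?Q"
        using openin_vietoris_subset[OF openin_diff[OF openin_topspace C(2)]]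
        by (intro openin_Int P_open) auto
      have SQ: "S \<in> ?Q"
        using S(1) 2 by (auto simp: P_iff closed_hyperspace_def dest: closedin_subset)
      have g: "?g T = (case n of 0 \<Rightarrow> f T | Suc m \<Rightarrow> f (T \<inter> C m))" if "T \<in> ?Q" for T
        using that by (intro first_miss_selection_first_miss) (auto simp: P_iff)
      have "openin ?V (?Q \<inter> {T \<in> topspace ?V. ?g T \<in> U})"
      proof (cases n)
        case 0
        then have "?Q \<inter> {T \<in> topspace ?V. ?g T \<in> U} = ?Q \<inter> {T \<in> topspace ?V. f T \<in> U}"
          using g by auto
        then show ?thesis
          using openin_Int[OF Q_open openin_continuous_map_preimage[OF cont U]] by simp
      next
        case (Suc m)
        \<comment> \<open>As \<open>n = Suc m\<close>, every member of \<open>?Q\<close> lies in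
          \<open>?H\<close>; since \<open>?H\<close> is open, relatively open subsets of it are
          open.\<close>
        let ?H = "{S \<in> closed_hyperspace X. S \<inter> C m \<noteq> {}}"
        have "continuous_map (subtopology ?V ?H) X (\<lambda>T. f (T \<inter> C m))"
          using continuous_map_compose[OF continuous_map_Int_clopen_vietoris[OF C] cont]
          by (simp add: o_def)
        then have "openin (subtopology ?V ?H)
            {T \<in> topspace (subtopology ?V ?H). f (T \<inter> C m) \<in> U}"
          using U by (rule openin_continuous_map_preimage)
        then have "openin ?V {T \<in> topspace (subtopology ?V ?H). f (T \<inter> C m) \<in> U}"
          using openin_vietoris_meets[OF C(1)] by (rule openin_trans_full)
        then have "openin ?V (?Q \<inter> {T \<in> topspace (subtopology ?V ?H). f (T \<inter> C m) \<in> U})"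
          by (rule openin_Int[OF Q_open])
        moreover have "?Q \<inter> {T \<in> topspace ?V. ?g T \<in> U} =
            ?Q \<inter> {T \<in> topspace (subtopology ?V ?H). f (T \<inter> C m) \<in> U}"
          using g Suc by (auto simp: P_iff)
        ultimately show ?thesis
          by (simp only:)
      qed
      then show ?thesis
        using S SQ by (intro exI[of _ "?Q \<inter> {T \<in> topspace ?V. ?g T \<in> U}"]) auto
    qed
  qed
  moreover have "?g S \<in> topspace X" if "S \<in> closed_hyperspace X" for S
    using g_sel[OF that] that closedin_subset[of X S] by (auto simp: closed_hyperspace_def)
  ultimately show ?thesis
    using g_sel by (auto simp: continuous_selection_def selection_def continuous_map_def)
qed

section \<open>Closedness of the set of selected points\<close>

theorem theorem4p2:
  fixes X :: "'a topology"
  assumes "infinite (topspace X)"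
    and "Hausdorff_space X"
    and "totally_disconnected_space X"
    and "first_countable X"
  shows "closedin X (O_cs X)"
proof -
  have nonempty: "topspace X \<noteq> {}"
    using assms(1) by auto
  then have whole: "topspace X \<in> closed_hyperspace X"
    by (simp add: closed_hyperspace_def)
  have "O_cs X \<subseteq> topspace X"
    using whole by (auto simp: O_cs_def continuous_selection_def selection_def)
  moreover have "p \<in> O_cs X" if "p \<in> X closure_of O_cs X" for p
  proof -
    have p: "p \<in> topspace X" "\<And>U. openin X U \<Longrightarrow> p \<in> U \<Longrightarrow> \<exists>y\<in>O_cs X. y \<in> U"
      using that unfolding in_closure_of by blast+
    \<comment> \<open>The whole space is a neighbourhood of \<open>p\<close>, so
      \<open>O_cs X\<close> is nonempty and supplies a selection to modify.\<close>
    obtain f where f: "continuous_selection X f"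
      using p(2)[OF openin_topspace p(1)] by (auto simp: O_cs_def)
    obtain W :: "nat \<Rightarrow> 'a set" where W: "\<And>n. openin X (W n)" "\<And>n. p \<in> W n" "decseq W"
      "\<And>U. openin X U \<Longrightarrow> p \<in> U \<Longrightarrow> \<exists>n. W n \<subseteq> U"
      using first_countable_decreasing_base[OF assms(4) p(1)] by blast
    have "\<exists>C. openin X C \<and> closedin X C \<and> C \<noteq> {} \<and> C \<subseteq> W n" for n
    proof -
      obtain g where "continuous_selection X g" "g (topspace X) \<in> W n"
        using p(2)[OF W(1,2)] by (auto simp: O_cs_def)
      then show ?thesis
        using nonempty_clopen_subset_of_selection_nhd[OF assms(2,3) _ nonempty W(1)] by metis
    qed
    then obtain C where C: "\<And>n. openin X (C n)" "\<And>n. closedin X (C n)"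
      "\<And>n. C n \<noteq> {}" "\<And>n. C n \<subseteq> W n"
      by metis
    \<comment> \<open>Once \<open>W n \<subseteq> U\<close>, monotonicity gives
      \<open>C m \<subseteq> W m \<subseteq> W n\<close> for all \<open>m \<ge> n\<close>.\<close>
    have "\<exists>n. \<forall>m\<ge>n. C m \<subseteq> U" if "openin X U" "p \<in> U" for U
      using W(4)[OF that] C(4) decseqD[OF W(3)] by (meson order_trans)
    then have "continuous_selection X (first_miss_selection f C p)"
      by (intro continuous_selection_first_miss f p(1) C)
    moreover have "first_miss_selection f C p (topspace X) = p"
      using C(3) openin_subset[OF C(1)]
      by (intro first_miss_selection_meets_all) (simp add: inf.absorb2)
    ultimately show ?thesis
      unfolding O_cs_def by (metis (mono_tags, lifting) mem_Collect_eq)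
  qed
  ultimately show ?thesis
    by (simp add: closure_of_subset_eq[symmetric] subsetI)
qed

end
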